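(* Let $n\ge 5$ be an integer and let $p(x)=(x-1)^n+(x+1)^n$. Then $$Z_{\mathbb R}\left(H_{\frac{n-1}{n}}[p]\right)=2n-4,$$ while $$Z_{\mathbb C}(p)=2\left\lfloor \frac n2\right\rfloor<Z_{\mathbb R}\left(H_{\frac{n-1}{n}}[p]\right).$$
   Context: For a real polynomial $p$ and a real number $\varkappa$, $H_{\varkappa}[p](x)=\varkappa\,(p'(x))^2-p(x)p''(x)$. For a real polynomial $f$, $Z_{\mathbb R}(f)$ denotes the number of real zeros of $f$ counted with multiplicity and $Z_{\mathbb C}(f)$ denotes the number of non-real zeros of $f$ counted with multiplicity. *)

theory Defs
  imports Complex_Main "HOL-Computational_Algebra.Polynomial"
begin

definition H :: "real \<Rightarrow> real poly \<Rightarrow> real poly" where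
  "H \<kappa> p = smult \<kappa> ((pderiv p)\<^sup>2) - p * pderiv (pderiv p)"

text \<open>
  Since \<open>proots 0 = {#}\<close>, both counts below are 0 for the zero polynomial; they are
  meaningful only for nonzero \<open>f\<close>.
\<close>

definition Z_real :: "real poly \<Rightarrow> nat" where
  "Z_real f = size (proots f)"

definition Z_nonreal :: "real poly \<Rightarrow> nat" where
  "Z_nonreal f = size {#z \<in># proots (map_poly complex_of_real f). z \<notin> \<real>#}"

end

theory Submission
  imports Defs "HOL-Computational_Algebra.Fundamental_Theorem_Algebra"
begin

text \<open>
  With \<open>A = x - 1\<close> and \<open>B = x + 1\<close>, the choice \<open>\<kappa> = (n - 1) / n\<close> makes the pure powers of \<open>A\<close> and
  of \<open>B\<close> cancel, leaving
  \<open>H \<kappa> p = -n (n - 1) (A B)\<^bsup>n - 2\<^esup> (A - B)\<^sup>2 = -4 n (n - 1) (A B)\<^bsup>n - 2\<^esup>\<close>.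
  The polynomial \<open>p\<close> has degree \<open>n\<close>, and its only real root is a simple root at the origin,
  present exactly when \<open>n\<close> is odd.
\<close>

lemma map_poly_of_real_linear_power:
  "map_poly complex_of_real ([:c, 1:] ^ n) = [:of_real c, 1:] ^ n"
proof (induction n)
  case (Suc n)
  have "map_poly complex_of_real ([:c, 1:] * q) = [:of_real c, 1:] * map_poly complex_of_real q" for q
    by (intro poly_eqI) (simp add: coeff_map_poly coeff_pCons split: nat.split)
  then show ?case
    by (simp only: power_Suc Suc.IH)
qed simp

text \<open>Both summands are monic of degree \<open>n\<close>, so their leading coefficients add up
  to 2, which is nonzero in characteristic 0.\<close>

lemma degree_sum_monic_linear_powers:
  fixes a b :: "'a :: {idom, ring_char_0}"
  shows "degree ([:a, 1:] ^ n + [:b, 1:] ^ n) = n"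
proof (rule antisym)
  have deg: "degree ([:c, 1:] ^ n) = n" for c :: 'a
    by (simp add: degree_power_eq)
  show "degree ([:a, 1:] ^ n + [:b, 1:] ^ n) \<le> n"
    by (rule degree_add_le) (simp_all add: deg)
  have "coeff ([:c, 1:] ^ n) n = 1" for c :: 'a
    using lead_coeff_power[of "[:c, 1:]" n] by (simp add: deg)
  then show "n \<le> degree ([:a, 1:] ^ n + [:b, 1:] ^ n)"
    by (intro le_degree) simp
qed

lemma sum_powers_shift_eq_0_iff:
  fixes x :: real
  assumes "n > 0"
  shows "(x - 1) ^ n + (x + 1) ^ n = 0 \<longleftrightarrow> odd n \<and> x = 0"
proof (cases "even n")
  case True
  then have "(x - 1) ^ n \<ge> 0" "(x + 1) ^ n \<ge> 0"
    by (simp_all add: zero_le_even_power)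
  then show ?thesis
    using True assms by (auto simp: add_nonneg_eq_0_iff)
next
  case False
  then have "(x - 1) ^ n = - ((1 - x) ^ n)"
    by (metis minus_diff_eq power_minus_odd)
  then have "(x - 1) ^ n + (x + 1) ^ n = 0 \<longleftrightarrow> (x + 1) ^ n = (1 - x) ^ n"
    by auto
  \<comment> \<open>Odd powers are injective on all of the reals; applying \<open>root n\<close>
    turns this into a cancellation.\<close>
  also have "\<dots> \<longleftrightarrow> root n ((x + 1) ^ n) = root n ((1 - x) ^ n)"
    using assms by simp
  also have "\<dots> \<longleftrightarrow> x + 1 = 1 - x"
    using False by (metis odd_real_root_power_cancel)
  finally show ?thesis
    using False by auto
qed

lemma pderiv_linear_power: "pderiv ([:c, 1:] ^ n) = smult (of_nat n) ([:c, 1:] ^ (n - 1))"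
  by (simp add: pderiv_power pderiv_pCons)

lemma H_sum_powers:
  assumes "n \<ge> 2"
  shows "H ((real n - 1) / real n) ([:-1, 1:] ^ n + [:1, 1:] ^ n)
    = smult (- 4 * real n * (real n - 1)) (([:-1, 1:] * [:1, 1:]) ^ (n - 2))"
proof -
  obtain m where n: "n = Suc (Suc m)"
    using assms by (metis Suc_le_D numeral_2_eq_2 Suc_le_mono)
  \<comment> \<open>With \<open>k = n - 1\<close>, let \<open>a\<close>, \<open>b\<close> stand for
    \<open>x - 1\<close>, \<open>x + 1\<close> and \<open>u\<close>, \<open>v\<close> for their
    powers of exponent \<open>n - 2\<close>. The three factors are then the values of p', p and p''.
    Treated as free variables, they leave only the cross terms in \<open>u * v\<close>.\<close>
  have *: "k / (k + 1) * ((k + 1) * (u * a + v * b))\<^sup>2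
      - (u * a\<^sup>2 + v * b\<^sup>2) * ((k + 1) * (k * (u + v)))
      = - (k * (k + 1)) * (u * v) * (a - b)\<^sup>2"
    if "k + 1 \<noteq> 0" for k u v a b :: real
  proof -
    have "k / (k + 1) * ((k + 1) * (u * a + v * b))\<^sup>2 = k * (k + 1) * (u * a + v * b)\<^sup>2"
      using that by (simp add: power2_eq_square)
    then show ?thesis
      by (simp add: power2_eq_square algebra_simps)
  qed
  show ?thesis
  proof (subst poly_eq_poly_eq_iff [symmetric], rule ext)
    fix x :: real
    let ?p = "[:-1, 1:] ^ n + [:1, 1:] ^ n :: real poly"
    have d1: "poly (pderiv ?p) x = real n * ((x - 1) ^ m * (x - 1) + (x + 1) ^ m * (x + 1))"
      unfolding pderiv_add pderiv_linear_power by (simp add: n algebra_simps)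
    have d2: "poly (pderiv (pderiv ?p)) x = real n * ((real n - 1) * ((x - 1) ^ m + (x + 1) ^ m))"
      unfolding pderiv_add pderiv_linear_power pderiv_smult by (simp add: n algebra_simps)
    have d0: "poly ?p x = (x - 1) ^ m * (x - 1)\<^sup>2 + (x + 1) ^ m * (x + 1)\<^sup>2"
      by (simp add: n power2_eq_square algebra_simps)
    have "poly (H ((real n - 1) / real n) ?p) x
        = - ((real n - 1) * real n) * ((x - 1) ^ m * (x + 1) ^ m) * (x - 1 - (x + 1))\<^sup>2"
      unfolding H_def poly_diff poly_smult poly_power poly_mult d0 d1 d2
      using *[of "real n - 1" "(x - 1) ^ m" "x - 1" "(x + 1) ^ m" "x + 1"] assms by simp
    \<comment> \<open>The square of \<open>x - 1 - (x + 1)\<close> is the constant 4.\<close>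
    also have "\<dots> = - 4 * real n * (real n - 1) * ((x - 1) * (x + 1)) ^ m"
      by (simp add: power_mult_distrib)
    also have "\<dots> = poly (smult (- 4 * real n * (real n - 1)) (([:-1, 1:] * [:1, 1:]) ^ (n - 2))) x"
      unfolding poly_smult poly_power poly_mult by (simp add: n add.commute)
    finally show "poly (H ((real n - 1) / real n) ?p) x
      = poly (smult (- 4 * real n * (real n - 1)) (([:-1, 1:] * [:1, 1:]) ^ (n - 2))) x" .
  qed
qed

text \<open>By the factorization of \<open>H\<close>, its roots are 1 and -1, each of multiplicity
  \<open>n - 2\<close>.\<close>

lemma Z_real_H_sum_powers:
  assumes "n \<ge> 2"
  shows "Z_real (H ((real n - 1) / real n) ([:-1, 1:] ^ n + [:1, 1:] ^ n)) = 2 * n - 4"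
proof -
  have "proots ([:-1, 1:] * [:1, 1:] :: real poly) = {#1, -1#}"
    by (subst proots_mult) simp_all
  then have "size (proots (([:-1, 1:] * [:1, 1:] :: real poly) ^ (n - 2))) = 2 * n - 4"
    unfolding proots_power size_repeat_mset by simp
  moreover have "- 4 * real n * (real n - 1) \<noteq> 0"
    using assms by simp
  ultimately show ?thesis
    unfolding Z_real_def H_sum_powers[OF assms] by (metis proots_smult)
qed

text \<open>Counted by complement: of the \<open>n\<close> complex roots exactly
  \<open>n mod 2\<close> are real, and \<open>n - n mod 2 = 2 * (n div 2)\<close>.\<close>

lemma Z_nonreal_sum_powers:
  assumes "n > 0"
  shows "Z_nonreal ([:-1, 1:] ^ n + [:1, 1:] ^ n) = 2 * (n div 2)"
proof -
  define P :: "complex poly" where "P = [:-1, 1:] ^ n + [:1, 1:] ^ n"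
  have map_P: "map_poly complex_of_real ([:-1, 1:] ^ n + [:1, 1:] ^ n) = P"
  proof -
    have "map_poly complex_of_real (q + r) = map_poly complex_of_real q + map_poly complex_of_real r" for q r
      by (intro poly_eqI) (simp add: coeff_map_poly)
    then show ?thesis
      by (simp add: P_def map_poly_of_real_linear_power)
  qed
  have deg: "degree P = n"
    unfolding P_def by (rule degree_sum_monic_linear_powers)
  then have "P \<noteq> 0"
    using assms by auto
  have real_root: "poly P z = 0 \<longleftrightarrow> odd n \<and> z = 0" if "z \<in> \<real>" for z
  proof -
    from that obtain x where z: "z = complex_of_real x"
      by (auto elim: Reals_cases)
    have "poly P z = complex_of_real ((x - 1) ^ n + (x + 1) ^ n)"
      by (simp add: P_def z add.commute)
    then show ?thesis
      using sum_powers_shift_eq_0_iff[OF assms, of x] by (simp only: of_real_eq_0_iff z)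
  qed
  have simple: "order 0 P = 1" if "odd n"
  proof -
    \<comment> \<open>Since \<open>n - 1\<close> is even, both terms of the derivative contribute
      \<open>n\<close> at the origin, so the root there is simple.\<close>
    have "poly (pderiv P) 0 = 2 * of_nat n"
      using that by (simp add: P_def pderiv_add pderiv_linear_power)
    then have "order 0 (pderiv P) = 0"
      using assms by (intro order_0I) simp
    moreover have "poly P 0 = 0"
      using real_root[of 0] that by simp
    ultimately show ?thesis
      using order_pderiv[of P 0] \<open>P \<noteq> 0\<close> by simp
  qed
  have "{#z \<in># proots P. z \<in> \<real>#} = (if odd n then {#0#} else {#})"
  proof (rule multiset_eqI)
    fix z
    show "count {#z \<in># proots P. z \<in> \<real>#} z = count (if odd n then {#0#} else {#}) z"
      using real_root[of z] simple \<open>P \<noteq> 0\<close> by (auto simp: order_0I)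
  qed
  then have "size {#z \<in># proots P. z \<in> \<real>#} = n mod 2"
    by (simp add: odd_iff_mod_2_eq_one even_iff_mod_2_eq_zero)
  moreover have "size {#z \<in># proots P. z \<in> \<real>#} + size {#z \<in># proots P. z \<notin> \<real>#} = n"
    using size_proots_complex[of P] deg by (metis multiset_partition size_union)
  ultimately show ?thesis
    unfolding Z_nonreal_def map_P by presburger
qed

theorem proposition2p1:
  fixes n :: nat and p :: "real poly"
  assumes "n \<ge> 5"
    and "p = [:-1, 1:] ^ n + [:1, 1:] ^ n"
  shows "Z_real (H ((real n - 1) / real n) p) = 2 * n - 4
    \<and> Z_nonreal p = 2 * (n div 2)
    \<and> Z_nonreal p < Z_real (H ((real n - 1) / real n) p)"
proof -
  have "Z_real (H ((real n - 1) / real n) p) = 2 * n - 4"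
    unfolding assms(2) by (rule Z_real_H_sum_powers) (use assms(1) in simp)
  moreover have "Z_nonreal p = 2 * (n div 2)"
    unfolding assms(2) by (rule Z_nonreal_sum_powers) (use assms(1) in simp)
  \<comment> \<open>The bound 5 is sharp: for \<open>n = 4\<close> both sides equal 4.\<close>
  moreover have "2 * (n div 2) < 2 * n - 4"
    using assms(1) by presburger
  ultimately show ?thesis
    by simp
qed

end
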